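(* Let $p$ and $q$ be distinct odd primes and $k\geq 3$ an odd integer. Let $S_k(n):=1^k+2^k+\cdots+n^k$, and let \[ A=\{k\in\mathbb{N}: k\not\equiv 1\pmod{p-1}\},\qquad B=\{k\in\mathbb{N}: k\equiv 1\pmod{q-1}\}. \] If $k\in A\setminus B$, then $(pq)^2\mid S_k(pq)$. Furthermore, if $k\in A$, then $(pq)^2\mid d\cdot S_k(pq)$, where \[ d=\begin{cases} q & \text{if } k\equiv 1\pmod{q-1} \text{ and } k\neq q,\\ 1 & \text{otherwise.}\end{cases} \] *)

theory Defs
  imports "HOL-Number_Theory.Number_Theory"
begin

definition power_sum :: "nat \<Rightarrow> nat \<Rightarrow> nat" where
  "power_sum k n = (\<Sum>i=1..n. i ^ k)"

definition set_A :: "nat \<Rightarrow> nat set" where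
  "set_A p = {k. \<not> [k = 1] (mod (p - 1))}"

definition set_B :: "nat \<Rightarrow> nat set" where
  "set_B q = {k. [k = 1] (mod (q - 1))}"

definition d_factor :: "nat \<Rightarrow> nat \<Rightarrow> nat" where
  "d_factor q k = (if [k = 1] (mod (q - 1)) \<and> k \<noteq> q then q else 1)"

end

theory Submission
  imports Defs
begin

text \<open>
  Pairing \<open>i\<close> with \<open>n - i\<close> and expanding \<open>(n - i)^k\<close> to first order in \<open>n\<close> gives, for odd \<open>k\<close>,
  \<open>2 S\<^sub>k(n) \<equiv> k n S\<^sub>k\<^sub>-\<^sub>1(n)\<close> modulo \<open>n\<^sup>2\<close>. So for odd \<open>n\<close> the divisibility
  \<open>n\<^sup>2 | d S\<^sub>k(n)\<close> follows from \<open>n | d k S\<^sub>k\<^sub>-\<^sub>1(n)\<close>. For \<open>n = p q\<close> the latter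
  is checked modulo each prime: \<open>p | S\<^sub>k\<^sub>-\<^sub>1(p q)\<close> because \<open>p - 1\<close> does not divide \<open>k - 1\<close>; likewise for
  \<open>q\<close>, unless \<open>q - 1\<close> divides \<open>k - 1\<close>, in which case \<open>q\<close> divides \<open>d k\<close>.
\<close>

text \<open>Multiplication by a primitive root \<open>g\<close> permutes the residues mod
  \<open>p\<close>, so the sum \<open>S\<close> satisfies \<open>S\<close> \<equiv>
  \<open>g ^ m * S\<close>. As \<open>g\<close> has order \<open>p - 1\<close>, \<open>g ^ m\<close>
  is not 1 mod \<open>p\<close>, hence \<open>S\<close> cannot be invertible.\<close>

lemma prime_dvd_sum_powers:
  fixes p m :: nat
  assumes p: "prime p" and m: "\<not> (p - 1) dvd m"
  shows "p dvd (\<Sum>i<p. i ^ m)"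
proof -
  have "p > 1" using p by (rule prime_gt_1_nat)
  obtain g where g: "residue_primroot p g"
    using prime_primitive_root_exists[OF \<open>p > 1\<close> p] by blast
  have cop: "coprime g p" and ord: "ord p g = p - 1"
    using g p by (auto simp: residue_primroot_def totient_prime coprime_commute)
  have gm: "\<not> [g ^ m = 1] (mod p)"
    using m ord ord_divides[of g m p] by simp
  define S where "S = (\<Sum>i<p. i ^ m)"
  have inj: "inj_on (\<lambda>i. g * i mod p) {..<p}"
  proof (rule inj_onI)
    fix x y assume "x \<in> {..<p}" "y \<in> {..<p}" "g * x mod p = g * y mod p"
    then show "x = y"
      using cong_mult_lcancel_nat[OF cop, of x y] by (simp add: cong_def)
  qed
  have "(\<lambda>i. g * i mod p) ` {..<p} = {..<p}"
    using inj \<open>p > 1\<close> by (intro card_subset_eq) (auto simp: card_image)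
  then have "S = (\<Sum>i<p. (g * i mod p) ^ m)"
    using sum.reindex[OF inj, of "\<lambda>i. i ^ m"] by (simp add: S_def)
  also have "[\<dots> = (\<Sum>i<p. (g * i) ^ m)] (mod p)"
    by (intro cong_sum cong_pow) simp
  also have "(\<Sum>i<p. (g * i) ^ m) = g ^ m * S"
    by (simp add: S_def power_mult_distrib sum_distrib_left)
  finally have *: "[1 * S = g ^ m * S] (mod p)" by simp
  have "\<not> coprime S p"
    using * gm cong_mult_rcancel_nat[of S p 1 "g ^ m"] by (auto simp: cong_sym_eq)
  then show ?thesis
    using p prime_imp_coprime[of p S] by (auto simp: S_def coprime_commute)
qed

lemma power_sum_eq_lessThan: "k > 0 \<Longrightarrow> power_sum k n = (\<Sum>i<n. i ^ k) + n ^ k"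
proof -
  assume k: "k > 0"
  have "power_sum k n = (\<Sum>i\<le>n. i ^ k)"
    unfolding power_sum_def using k by (intro sum.mono_neutral_left) auto
  then show ?thesis by (simp add: lessThan_Suc_atMost[symmetric])
qed

text \<open>The range below \<open>n * p\<close> splits into \<open>n\<close> complete residue
  systems mod \<open>p\<close>, each summing to 0.\<close>

lemma prime_dvd_power_sum_mult:
  fixes p n m :: nat
  assumes p: "prime p" and m: "\<not> (p - 1) dvd m"
  shows "p dvd power_sum m (n * p)"
proof -
  have "m > 0" using m by (cases m) auto
  have split: "(\<Sum>i<a + b. f i) = (\<Sum>i<a. f i) + (\<Sum>i<b. f (a + i))" for f :: "nat \<Rightarrow> nat" and a b
    by (induction b) (simp_all add: add.assoc)
  have "p dvd (\<Sum>i<n * p. i ^ m)"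
  proof (induction n)
    case (Suc n)
    have "(\<Sum>i<Suc n * p. i ^ m) = (\<Sum>i<n * p. i ^ m) + (\<Sum>i<p. (n * p + i) ^ m)"
      using split[of "\<lambda>i. i ^ m" "n * p" p] by (simp add: add.commute)
    moreover have "[(\<Sum>i<p. (n * p + i) ^ m) = (\<Sum>i<p. i ^ m)] (mod p)"
      by (intro cong_sum cong_pow) (simp add: cong_def)
    ultimately show ?case
      using Suc prime_dvd_sum_powers[OF p m] cong_dvd_iff by (metis dvd_add)
  qed simp
  moreover have "p dvd (n * p) ^ m"
    using \<open>m > 0\<close> by (intro dvd_trans[OF dvd_triv_right dvd_power]) simp
  ultimately show ?thesis
    using \<open>m > 0\<close> by (simp add: power_sum_eq_lessThan)
qed

text \<open>Binomial expansion truncated after the linear term; over the integers because it is used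
  with negative \<open>b\<close>.\<close>

lemma power_add_cong_first_order:
  fixes a b :: int
  shows "[(a + b) ^ Suc m = b ^ Suc m + int (Suc m) * a * b ^ m] (mod a\<^sup>2)"
proof (induction m)
  case (Suc m)
  have "[(a + b) ^ Suc (Suc m) = (a + b) * (b ^ Suc m + int (Suc m) * a * b ^ m)] (mod a\<^sup>2)"
    using cong_mult[OF cong_refl Suc, of "a + b"] by simp
  also have "(a + b) * (b ^ Suc m + int (Suc m) * a * b ^ m) =
      b ^ Suc (Suc m) + int (Suc (Suc m)) * a * b ^ Suc m + a\<^sup>2 * (int (Suc m) * b ^ m)"
    by (simp add: algebra_simps power2_eq_square)
  also have "[\<dots> = b ^ Suc (Suc m) + int (Suc (Suc m)) * a * b ^ Suc m] (mod a\<^sup>2)"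
    by (simp add: cong_def)
  finally show ?case .
qed (simp add: add.commute)

lemma double_power_sum_cong:
  fixes n m :: nat
  assumes "even m" "m > 0"
  shows "[2 * power_sum (Suc m) n = Suc m * n * power_sum m n] (mod n\<^sup>2)"
proof -
  \<comment> \<open>Adding the zero term \<open>i = 0\<close> makes the range symmetric under
    \<open>i\<close> to \<open>n - i\<close>.\<close>
  have sum: "int (power_sum j n) = (\<Sum>i\<le>n. int i ^ j)" if "j > 0" for j
    using that by (simp add: power_sum_eq_lessThan lessThan_Suc_atMost[symmetric])
  have "2 * int (power_sum (Suc m) n) = (\<Sum>i\<le>n. int i ^ Suc m) + (\<Sum>i\<le>n. int (n - i) ^ Suc m)"
    using sum.nat_diff_reindex[of "\<lambda>i. int i ^ Suc m" "Suc n"]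
    by (simp add: sum lessThan_Suc_atMost del: power_Suc sum.lessThan_Suc)
  also have "\<dots> = (\<Sum>i\<le>n. int i ^ Suc m + (int n + - int i) ^ Suc m)"
    by (simp add: sum.distrib of_nat_diff del: power_Suc)
  also have "[\<dots> = (\<Sum>i\<le>n. int i ^ Suc m +
      ((- int i) ^ Suc m + int (Suc m) * int n * (- int i) ^ m))] (mod (int n)\<^sup>2)"
    by (intro cong_sum cong_add cong_refl power_add_cong_first_order)
  \<comment> \<open>Since \<open>m\<close> is even, \<open>(- int i) ^ Suc m\<close> cancels
    \<open>int i ^ Suc m\<close>, and the sign in the linear term disappears.\<close>
  also have "(\<Sum>i\<le>n. int i ^ Suc m +
      ((- int i) ^ Suc m + int (Suc m) * int n * (- int i) ^ m)) =
      int (Suc m) * int n * (\<Sum>i\<le>n. int i ^ m)"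
    using assms by (simp add: sum_distrib_left)
  finally have "[int (2 * power_sum (Suc m) n) = int (Suc m * n * power_sum m n)] (mod int (n\<^sup>2))"
    using assms by (simp add: sum del: power_Suc of_nat_Suc mult_Suc)
  then show ?thesis by (simp only: cong_int_iff)
qed

lemma square_dvd_mult_power_sum:
  fixes d n m :: nat
  assumes "odd n" "even m" "m > 0" and dvd: "n dvd d * Suc m * power_sum m n"
  shows "n\<^sup>2 dvd d * power_sum (Suc m) n"
proof -
  have "[d * (2 * power_sum (Suc m) n) = d * (Suc m * n * power_sum m n)] (mod n\<^sup>2)"
    using assms by (intro cong_mult cong_refl double_power_sum_cong)
  moreover have "n\<^sup>2 dvd d * (Suc m * n * power_sum m n)"
    using mult_dvd_mono[OF dvd_refl[of n] dvd] by (simp add: power2_eq_square mult_ac del: mult_Suc mult_Suc_right)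
  ultimately have "n\<^sup>2 dvd 2 * (d * power_sum (Suc m) n)"
    by (simp add: cong_dvd_iff mult.left_commute)
  moreover have "coprime (n\<^sup>2) 2" using \<open>odd n\<close> by simp
  ultimately show ?thesis by (simp only: coprime_dvd_mult_right_iff)
qed

theorem theorem3p4:
  fixes p q k :: nat
  assumes "prime p" and "odd p"
    and "prime q" and "odd q"
    and "p \<noteq> q"
    and "k \<ge> 3" and "odd k"
  shows "(k \<in> set_A p - set_B q \<longrightarrow> (p * q)\<^sup>2 dvd power_sum k (p * q)) \<and>
         (k \<in> set_A p \<longrightarrow> (p * q)\<^sup>2 dvd d_factor q k * power_sum k (p * q))"
proof -
  obtain m where k: "k = Suc m" using \<open>k \<ge> 3\<close> by (cases k) auto
  have m: "even m" "m > 0" using k \<open>k \<ge> 3\<close> \<open>odd k\<close> by auto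
  \<comment> \<open>\<open>Suc 0\<close> is the form that simp gives to the \<open>1\<close> in the
    definitions.\<close>
  have cong_iff: "[k = Suc 0] (mod r) \<longleftrightarrow> r dvd m" for r
    using cong_altdef_nat[of 1 k r] by (simp add: k)
  have main: "(p * q)\<^sup>2 dvd d_factor q k * power_sum k (p * q)" if "k \<in> set_A p"
  proof -
    have "p dvd power_sum m (p * q)"
      using prime_dvd_power_sum_mult[OF \<open>prime p\<close>, of m q] that
      by (simp add: set_A_def cong_iff mult.commute)
    moreover have "q dvd d_factor q k * Suc m * power_sum m (p * q)"
    proof (cases "(q - 1) dvd m")
      case True
      \<comment> \<open>If \<open>k = q\<close>, the factor \<open>Suc m\<close> is \<open>q\<close>
        itself; otherwise \<open>d_factor q k = q\<close>.\<close>
      then show ?thesis by (cases "k = q") (auto simp: d_factor_def cong_iff k[symmetric])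
    next
      case False
      then show ?thesis using prime_dvd_power_sum_mult[OF \<open>prime q\<close>] by simp
    qed
    moreover have "coprime p q" using assms by (simp add: primes_coprime)
    ultimately have "p * q dvd d_factor q k * Suc m * power_sum m (p * q)"
      by (simp add: divides_mult)
    then show ?thesis
      using square_dvd_mult_power_sum[of "p * q" m] m assms(2,4) by (simp add: k)
  qed
  \<comment> \<open>Outside \<open>set_B q\<close> the factor is 1, so \<open>main\<close> gives
    both claims.\<close>
  then show ?thesis by (auto simp: set_B_def d_factor_def)
qed

end
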